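(* Let $u^*\in BV(\Omega)\cap L^2(\Omega)$ be a minimizer of $$E(u):=\alpha_1\|Tu-g\|_{L^1(\Omega)}+\alpha_2\|Tu-g\|_{L^2(\Omega)}^2+\lambda\operatorname{TV}(u)$$ over $BV(\Omega)\cap L^2(\Omega)$, let $v\in L^2(\Omega)$, and let $\xi_G\in\partial G(v)$, where $G:L^2(\Omega)\to\overline{\mathbb{R}}$, $G(u):=\alpha_1\|Tu-g\|_{L^1(\Omega)}+\lambda\operatorname{TV}(u)$. Then, if $v\neq u^*$, $$\alpha_2\frac{\|T(u^*-v)\|_{L^2(\Omega)}^2}{\|u^*-v\|_{L^2(\Omega)}}\le 2\alpha_2\|T^*(Tv-g)\|_{L^2(\Omega)}+\|\xi_G\|_{L^2(\Omega)}.$$ If moreover there exists a constant $\tilde c>0$ such that $\alpha_2\|Tu\|_{L^2(\Omega)}^2\ge\tilde c\,\|u\|_{L^2(\Omega)}^2$ for all $u\in L^2(\Omega)$, then $$\tilde c\,\|u^*-v\|_{L^2(\Omega)}\le 2\alpha_2\|T^*(Tv-g)\|_{L^2(\Omega)}+\|\xi_G\|_{L^2(\Omega)}.$$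
   Context: $\Omega\subset\mathbb{R}^d$, $d\in\{1,2\}$, is an open, bounded and simply connected domain with Lipschitz boundary; $T:L^2(\Omega)\to L^2(\Omega)$ is a bounded linear operator with adjoint $T^*$; $g\in L^2(\Omega)$; $\alpha_1,\alpha_2,\lambda\ge 0$; $\overline{\mathbb{R}}:=\mathbb{R}\cup\{+\infty\}$. For $u\in L^1(\Omega)$, $$\operatorname{TV}(u):=\sup\Big\{\int_\Omega u\,\operatorname{div} q\,dx : q\in C_c^1(\Omega)^d,\ |q(x)|_2\le 1 \text{ for almost all } x\in\Omega\Big\},$$ and $BV(\Omega):=\{u\in L^1(\Omega):\operatorname{TV}(u)<\infty\}$. The subdifferential of a convex functional $F:L^2(\Omega)\to\overline{\mathbb{R}}$ at $v$ is $\partial F(v)=\emptyset$ if $F(v)=\infty$, and otherwise $\partial F(v)=\{\xi\in L^2(\Omega):\langle\xi,u-v\rangle+F(v)\le F(u)\ \ \forall u\in L^2(\Omega)\}$, with $\langle\cdot,\cdot\rangle$ the $L^2(\Omega)$ inner product (identifying $L^2(\Omega)^*$ with $L^2(\Omega)$). *)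

theory Defs
  imports "HOL-Analysis.Analysis"
begin

text \<open>
  Elements of \<open>L\<^sup>1(\<Omega>)\<close> and \<open>L\<^sup>2(\<Omega>)\<close> are represented by functions on the ambient space; only
  their values on \<open>\<Omega>\<close> matter, and equality in \<open>L\<^sup>2(\<Omega>)\<close> is equality almost everywhere
  on \<open>\<Omega>\<close> (\<open>AE x in lebesgue_on \<Omega>\<close>).
\<close>

definition L1_space :: "'a::euclidean_space set \<Rightarrow> ('a \<Rightarrow> real) set" where
  "L1_space \<Omega> = {u. integrable (lebesgue_on \<Omega>) u}"

definition L2_space :: "'a::euclidean_space set \<Rightarrow> ('a \<Rightarrow> real) set" where
  "L2_space \<Omega> = {u. u \<in> borel_measurable (lebesgue_on \<Omega>) \<and>
                    integrable (lebesgue_on \<Omega>) (\<lambda>x. (u x)\<^sup>2)}"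

definition L1_norm :: "'a::euclidean_space set \<Rightarrow> ('a \<Rightarrow> real) \<Rightarrow> real" where
  "L1_norm \<Omega> u = integral\<^sup>L (lebesgue_on \<Omega>) (\<lambda>x. \<bar>u x\<bar>)"

definition L2_inner :: "'a::euclidean_space set \<Rightarrow> ('a \<Rightarrow> real) \<Rightarrow> ('a \<Rightarrow> real) \<Rightarrow> real" where
  "L2_inner \<Omega> u w = integral\<^sup>L (lebesgue_on \<Omega>) (\<lambda>x. u x * w x)"

definition L2_norm :: "'a::euclidean_space set \<Rightarrow> ('a \<Rightarrow> real) \<Rightarrow> real" where
  "L2_norm \<Omega> u = sqrt (L2_inner \<Omega> u u)"

text \<open>The second conjunct says that \<open>T\<close> is well defined on almost-everywhere classes.\<close>

definition bounded_linear_L2 ::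
  "'a::euclidean_space set \<Rightarrow> (('a \<Rightarrow> real) \<Rightarrow> ('a \<Rightarrow> real)) \<Rightarrow> bool" where
  "bounded_linear_L2 \<Omega> T \<longleftrightarrow>
     (\<forall>u\<in>L2_space \<Omega>. T u \<in> L2_space \<Omega>) \<and>
     (\<forall>u\<in>L2_space \<Omega>. \<forall>w\<in>L2_space \<Omega>.
        (AE x in lebesgue_on \<Omega>. u x = w x) \<longrightarrow> (AE x in lebesgue_on \<Omega>. T u x = T w x)) \<and>
     (\<forall>u\<in>L2_space \<Omega>. \<forall>w\<in>L2_space \<Omega>.
        AE x in lebesgue_on \<Omega>. T (\<lambda>y. u y + w y) x = T u x + T w x) \<and>
     (\<forall>u\<in>L2_space \<Omega>. \<forall>c. AE x in lebesgue_on \<Omega>. T (\<lambda>y. c * u y) x = c * T u x) \<and>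
     (\<exists>C. \<forall>u\<in>L2_space \<Omega>. L2_norm \<Omega> (T u) \<le> C * L2_norm \<Omega> u)"

text \<open>
  On \<open>L\<^sup>2(\<Omega>)\<close> the adjoint is determined up to almost-everywhere equality by this property.
\<close>

definition is_adjoint_L2 ::
  "'a::euclidean_space set \<Rightarrow> (('a \<Rightarrow> real) \<Rightarrow> ('a \<Rightarrow> real)) \<Rightarrow>
   (('a \<Rightarrow> real) \<Rightarrow> ('a \<Rightarrow> real)) \<Rightarrow> bool" where
  "is_adjoint_L2 \<Omega> T Tadj \<longleftrightarrow>
     (\<forall>w\<in>L2_space \<Omega>. Tadj w \<in> L2_space \<Omega>) \<and>
     (\<forall>u\<in>L2_space \<Omega>. \<forall>w\<in>L2_space \<Omega>. L2_inner \<Omega> (T u) w = L2_inner \<Omega> u (Tadj w))"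

text \<open>
  Near each boundary point, in a suitable orthonormal frame with last axis \<open>e\<close>, the set is the
  strict epigraph of a Lipschitz function \<open>\<gamma>\<close> on the hyperplane orthogonal to \<open>e\<close>. In dimension 1
  that hyperplane is \<open>{0}\<close> and \<open>\<gamma>\<close> is a constant.
\<close>

definition lipschitz_boundary :: "'a::euclidean_space set \<Rightarrow> bool" where
  "lipschitz_boundary \<Omega> \<longleftrightarrow>
     (\<forall>p\<in>frontier \<Omega>. \<exists>e r L (\<gamma>::'a \<Rightarrow> real).
        norm e = 1 \<and> r > 0 \<and> L-lipschitz_on {y. e \<bullet> y = 0} \<gamma> \<and>
        \<Omega> \<inter> ball p r = {x \<in> ball p r. \<gamma> (x - (e \<bullet> x) *\<^sub>R e) < e \<bullet> x})"

definition divergence :: "(real^'n \<Rightarrow> real^'n) \<Rightarrow> real^'n \<Rightarrow> real" where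
  "divergence q x = trace (matrix (frechet_derivative q (at x)))"

text \<open>
  \<open>C\<^sub>c\<^sup>1(\<Omega>)\<^sup>d\<close>, each field being identified with its extension by zero to the whole space.
\<close>

definition C1c_fields :: "(real^'n) set \<Rightarrow> (real^'n \<Rightarrow> real^'n) set" where
  "C1c_fields \<Omega> = {q. (\<forall>x. q differentiable (at x)) \<and>
                      (\<forall>h. continuous_on UNIV (\<lambda>x. frechet_derivative q (at x) h)) \<and>
                      compact (closure {x. q x \<noteq> 0}) \<and> closure {x. q x \<noteq> 0} \<subseteq> \<Omega>}"

definition TV :: "(real^'n) set \<Rightarrow> (real^'n \<Rightarrow> real) \<Rightarrow> ereal" where
  "TV \<Omega> u = (SUP q \<in> {q \<in> C1c_fields \<Omega>. AE x in lebesgue_on \<Omega>. norm (q x) \<le> 1}.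
               ereal (integral\<^sup>L (lebesgue_on \<Omega>) (\<lambda>x. u x * divergence q x)))"

definition BV :: "(real^'n) set \<Rightarrow> (real^'n \<Rightarrow> real) set" where
  "BV \<Omega> = {u \<in> L1_space \<Omega>. TV \<Omega> u < \<infinity>}"

definition subdifferential_L2 ::
  "'a::euclidean_space set \<Rightarrow> (('a \<Rightarrow> real) \<Rightarrow> ereal) \<Rightarrow> ('a \<Rightarrow> real) \<Rightarrow> ('a \<Rightarrow> real) set" where
  "subdifferential_L2 \<Omega> F v =
     (if F v = \<infinity> then {}
      else {\<xi> \<in> L2_space \<Omega>. \<forall>u\<in>L2_space \<Omega>. ereal (L2_inner \<Omega> \<xi> (u - v)) + F v \<le> F u})"

text \<open>
  For \<open>lam = 0\<close> the library convention \<open>0 * \<infinity> = 0\<close> applies, so \<open>G_functional\<close> is then finite on all of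
  \<open>L\<^sup>2(\<Omega>)\<close>.
\<close>

definition E_functional ::
  "(real^'n) set \<Rightarrow> ((real^'n \<Rightarrow> real) \<Rightarrow> (real^'n \<Rightarrow> real)) \<Rightarrow> (real^'n \<Rightarrow> real) \<Rightarrow>
   real \<Rightarrow> real \<Rightarrow> real \<Rightarrow> (real^'n \<Rightarrow> real) \<Rightarrow> ereal" where
  "E_functional \<Omega> T g \<alpha>1 \<alpha>2 lam u =
     ereal (\<alpha>1 * L1_norm \<Omega> (T u - g)) + ereal (\<alpha>2 * (L2_norm \<Omega> (T u - g))\<^sup>2) + ereal lam * TV \<Omega> u"

definition G_functional ::
  "(real^'n) set \<Rightarrow> ((real^'n \<Rightarrow> real) \<Rightarrow> (real^'n \<Rightarrow> real)) \<Rightarrow> (real^'n \<Rightarrow> real) \<Rightarrow>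
   real \<Rightarrow> real \<Rightarrow> (real^'n \<Rightarrow> real) \<Rightarrow> ereal" where
  "G_functional \<Omega> T g \<alpha>1 lam u = ereal (\<alpha>1 * L1_norm \<Omega> (T u - g)) + ereal lam * TV \<Omega> u"

end

theory Submission
  imports Defs
begin

text \<open>
  Write \<open>E = G + \<alpha>2 \<parallel>T u - g\<parallel>\<^sup>2\<close> and \<open>w = u\<^sup>* - v\<close>. The subgradient inequality for \<open>\<xi>\<close> at \<open>v\<close>, tested with
  \<open>u\<^sup>*\<close>, and the minimality \<open>E u\<^sup>* \<le> E v\<close> give
  \<open>\<langle>\<xi>, w\<rangle> \<le> G u\<^sup>* - G v \<le> \<alpha>2 (\<parallel>T v - g\<parallel>\<^sup>2 - \<parallel>T u\<^sup>* - g\<parallel>\<^sup>2)\<close>.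
  As \<open>T u\<^sup>* - g = T w + (T v - g)\<close> almost everywhere, the right-hand side equals
  \<open>- \<alpha>2 \<parallel>T w\<parallel>\<^sup>2 - 2 \<alpha>2 \<langle>w, T\<^sup>* (T v - g)\<rangle>\<close> (lemma \<open>residual_expansion\<close>), and the Cauchy--Schwarz
  inequality yields \<open>\<alpha>2 \<parallel>T w\<parallel>\<^sup>2 \<le> (2 \<alpha>2 \<parallel>T\<^sup>* (T v - g)\<parallel> + \<parallel>\<xi>\<parallel>) \<parallel>w\<parallel>\<close> (lemma \<open>subgradient_estimate\<close>). Dividing
  by \<open>\<parallel>w\<parallel>\<close>, after inserting the coercivity for the second claim, finishes the proof.

  The delicate point is \<open>E u\<^sup>* \<le> E v\<close> (lemma \<open>minimiser_le\<close>), because \<open>u\<^sup>*\<close> minimises only over functions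
  of bounded variation. For \<open>lam > 0\<close> a nonempty subdifferential forces the total variation of \<open>v\<close> to
  be finite. For \<open>lam = 0\<close> it says nothing about it, and \<open>v\<close> has to be approximated: \<open>E\<close> is then
  continuous on \<open>L\<^sup>2\<close>, polynomials are dense in \<open>L\<^sup>2(\<Omega>)\<close> (lemma \<open>L2_approx_polynomial\<close>), and polynomials
  have bounded variation on a bounded open set by integration by parts (lemma \<open>TV_finite_C1\<close>).
\<close>

section \<open>The inner product and norms on square-integrable functions\<close>

lemma L2_space_integrable_mult:
  assumes "u \<in> L2_space \<Omega>" "w \<in> L2_space \<Omega>"
  shows "integrable (lebesgue_on \<Omega>) (\<lambda>x. u x * w x)"
proof (rule Bochner_Integration.integrable_bound)
  show "integrable (lebesgue_on \<Omega>) (\<lambda>x. (u x)\<^sup>2 + (w x)\<^sup>2)"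
    using assms by (auto simp: L2_space_def)
  show "(\<lambda>x. u x * w x) \<in> borel_measurable (lebesgue_on \<Omega>)"
    using assms by (auto simp: L2_space_def)
  have "\<bar>a * b\<bar> \<le> \<bar>a\<^sup>2 + b\<^sup>2\<bar>" for a b :: real
    using sum_squares_bound[of a b] sum_squares_bound[of a "-b"] by (simp add: abs_le_iff)
  then show "AE x in lebesgue_on \<Omega>. norm (u x * w x) \<le> norm ((u x)\<^sup>2 + (w x)\<^sup>2)"
    by simp
qed

lemma L2_space_lin:
  assumes u: "u \<in> L2_space \<Omega>" and w: "w \<in> L2_space \<Omega>"
  shows "(\<lambda>x. a * u x + b * w x) \<in> L2_space \<Omega>"
proof -
  have "(a * u x + b * w x)\<^sup>2 = a\<^sup>2 * (u x)\<^sup>2 + 2 * a * b * (u x * w x) + b\<^sup>2 * (w x)\<^sup>2" for x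
    by (simp add: power2_eq_square algebra_simps)
  moreover have "integrable (lebesgue_on \<Omega>) (\<lambda>x. a\<^sup>2 * (u x)\<^sup>2 + 2 * a * b * (u x * w x) + b\<^sup>2 * (w x)\<^sup>2)"
    using u w L2_space_integrable_mult[OF u w] by (auto simp: L2_space_def)
  ultimately show ?thesis using u w by (auto simp: L2_space_def)
qed

lemma L2_space_diff:
  assumes "u \<in> L2_space \<Omega>" "w \<in> L2_space \<Omega>"
  shows "u - w \<in> L2_space \<Omega>"
  using L2_space_lin[OF assms, of 1 "-1"] by (simp add: fun_diff_def)

lemma L2_norm_nonneg: "0 \<le> L2_norm \<Omega> u"
  by (simp add: L2_norm_def L2_inner_def)

lemma L2_norm_sq: "(L2_norm \<Omega> u)\<^sup>2 = L2_inner \<Omega> u u"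
  by (simp add: L2_norm_def L2_inner_def)

lemma L2_inner_AE_cong:
  assumes "u \<in> L2_space \<Omega>" "u' \<in> L2_space \<Omega>" "w \<in> L2_space \<Omega>" "w' \<in> L2_space \<Omega>"
    and "AE x in lebesgue_on \<Omega>. u x = u' x" "AE x in lebesgue_on \<Omega>. w x = w' x"
  shows "L2_inner \<Omega> u w = L2_inner \<Omega> u' w'"
  unfolding L2_inner_def
  by (rule integral_cong_AE) (use assms in \<open>auto simp: L2_space_def\<close>)

lemma L2_norm_sq_lin:
  assumes u: "u \<in> L2_space \<Omega>" and w: "w \<in> L2_space \<Omega>"
  shows "(L2_norm \<Omega> (\<lambda>x. a * u x + b * w x))\<^sup>2
    = a\<^sup>2 * (L2_norm \<Omega> u)\<^sup>2 + 2 * a * b * L2_inner \<Omega> u w + b\<^sup>2 * (L2_norm \<Omega> w)\<^sup>2"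
proof -
  have *: "(a * u x + b * w x) * (a * u x + b * w x)
     = a\<^sup>2 * (u x * u x) + 2 * a * b * (u x * w x) + b\<^sup>2 * (w x * w x)" for x
    by (simp add: power2_eq_square algebra_simps)
  show ?thesis
    unfolding L2_norm_sq L2_inner_def *
    using L2_space_integrable_mult[OF u w] L2_space_integrable_mult[OF u u]
      L2_space_integrable_mult[OF w w] by simp
qed

text \<open>
  The quadratic form \<open>a\<^sup>2 \<parallel>u\<parallel>\<^sup>2 + 2 a b \<langle>u, w\<rangle> + b\<^sup>2 \<parallel>w\<parallel>\<^sup>2\<close> is the squared norm of \<open>a u + b w\<close>, hence
  nonnegative; the choice \<open>a = \<parallel>w\<parallel>\<^sup>2\<close>, \<open>b = - \<langle>u, w\<rangle>\<close> gives the inequality when \<open>\<parallel>w\<parallel> \<noteq> 0\<close>.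
\<close>
lemma L2_Cauchy_Schwarz:
  assumes u: "u \<in> L2_space \<Omega>" and w: "w \<in> L2_space \<Omega>"
  shows "\<bar>L2_inner \<Omega> u w\<bar> \<le> L2_norm \<Omega> u * L2_norm \<Omega> w"
proof -
  define A where "A = L2_norm \<Omega> u"
  define B where "B = L2_norm \<Omega> w"
  define I where "I = L2_inner \<Omega> u w"
  have AB: "A \<ge> 0" "B \<ge> 0" by (simp_all add: A_def B_def L2_norm_nonneg)
  have quad: "0 \<le> a\<^sup>2 * A\<^sup>2 + 2 * a * b * I + b\<^sup>2 * B\<^sup>2" for a b
    using L2_norm_sq_lin[OF u w, of a b] zero_le_power2 unfolding A_def B_def I_def by metis
  have "I\<^sup>2 \<le> A\<^sup>2 * B\<^sup>2"
  proof (cases "B = 0")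
    case True
    have "I = 0"
      \<comment> \<open>otherwise the form is affine and nonconstant in \<open>b\<close>, so it takes the value \<open>-1\<close>\<close>
    proof (rule ccontr)
      assume "I \<noteq> 0"
      with quad[of 1 "- (A\<^sup>2 + 1) / (2 * I)"] True show False by (simp add: field_simps)
    qed
    then show ?thesis by simp
  next
    case False
    then have "B\<^sup>2 > 0" by simp
    have "0 \<le> (B\<^sup>2)\<^sup>2 * A\<^sup>2 + 2 * B\<^sup>2 * (- I) * I + (- I)\<^sup>2 * B\<^sup>2"
      using quad[of "B\<^sup>2" "- I"] by simp
    also have "\<dots> = B\<^sup>2 * (A\<^sup>2 * B\<^sup>2 - I\<^sup>2)" by (simp add: power2_eq_square algebra_simps)
    finally show ?thesis using \<open>B\<^sup>2 > 0\<close> by (simp add: zero_le_mult_iff)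
  qed
  then have "\<bar>I\<bar>\<^sup>2 \<le> (A * B)\<^sup>2" by (simp add: power_mult_distrib)
  then have "\<bar>I\<bar> \<le> A * B" by (rule power2_le_imp_le) (use AB in simp)
  then show ?thesis by (simp add: A_def B_def I_def)
qed

lemma L2_norm_triangle:
  assumes u: "u \<in> L2_space \<Omega>" and w: "w \<in> L2_space \<Omega>"
  shows "L2_norm \<Omega> (\<lambda>x. u x + w x) \<le> L2_norm \<Omega> u + L2_norm \<Omega> w"
proof (rule power2_le_imp_le)
  show "(L2_norm \<Omega> (\<lambda>x. u x + w x))\<^sup>2 \<le> (L2_norm \<Omega> u + L2_norm \<Omega> w)\<^sup>2"
    using L2_norm_sq_lin[OF u w, of 1 1] L2_Cauchy_Schwarz[OF u w] by (simp add: power2_sum)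
qed (simp add: L2_norm_nonneg)

lemma finite_measure_bounded_open:
  assumes "open \<Omega>" "bounded \<Omega>"
  shows "finite_measure (lebesgue_on \<Omega>)"
  using assms by (simp add: finite_measure_lebesgue_on lmeasurable_open)

lemma L2_space_const:
  assumes "open \<Omega>" "bounded \<Omega>"
  shows "(\<lambda>x. c) \<in> L2_space \<Omega>"
proof -
  interpret finite_measure "lebesgue_on \<Omega>" using assms by (rule finite_measure_bounded_open)
  show ?thesis by (simp add: L2_space_def)
qed

lemma L2_space_abs: "u \<in> L2_space \<Omega> \<Longrightarrow> (\<lambda>x. \<bar>u x\<bar>) \<in> L2_space \<Omega>"
  by (auto simp: L2_space_def)

lemma L2_space_integrable:
  assumes "open \<Omega>" "bounded \<Omega>" "u \<in> L2_space \<Omega>"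
  shows "integrable (lebesgue_on \<Omega>) u"
  using L2_space_integrable_mult[OF assms(3) L2_space_const[OF assms(1,2), of 1]] by simp

lemma L1_norm_le_L2_norm:
  assumes "open \<Omega>" "bounded \<Omega>" "u \<in> L2_space \<Omega>"
  shows "L1_norm \<Omega> u \<le> L2_norm \<Omega> (\<lambda>x. 1) * L2_norm \<Omega> u"
  using L2_Cauchy_Schwarz[OF L2_space_const[OF assms(1,2), of 1] L2_space_abs[OF assms(3)]]
  by (simp add: L1_norm_def L2_norm_def L2_inner_def)

lemma L1_norm_triangle:
  assumes "open \<Omega>" "bounded \<Omega>" "u \<in> L2_space \<Omega>" "w \<in> L2_space \<Omega>"
  shows "L1_norm \<Omega> (\<lambda>x. u x + w x) \<le> L1_norm \<Omega> u + L1_norm \<Omega> w"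
proof -
  have i: "integrable (lebesgue_on \<Omega>) u" "integrable (lebesgue_on \<Omega>) w"
    using L2_space_integrable assms by blast+
  have "L1_norm \<Omega> (\<lambda>x. u x + w x) \<le> integral\<^sup>L (lebesgue_on \<Omega>) (\<lambda>x. \<bar>u x\<bar> + \<bar>w x\<bar>)"
    unfolding L1_norm_def by (rule integral_mono) (use i in auto)
  also have "\<dots> = L1_norm \<Omega> u + L1_norm \<Omega> w"
    using i by (simp add: L1_norm_def)
  finally show ?thesis .
qed

section \<open>Bounded operators and the residual\<close>

lemma bounded_linear_L2_diff:
  assumes T: "bounded_linear_L2 \<Omega> T" and u: "u \<in> L2_space \<Omega>" and w: "w \<in> L2_space \<Omega>"
  shows "AE x in lebesgue_on \<Omega>. T (u - w) x = T u x - T w x"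
proof -
  have m: "(\<lambda>y. -1 * w y) \<in> L2_space \<Omega>"
    using L2_space_lin[OF w w, of "-1" 0] by simp
  have "AE x in lebesgue_on \<Omega>. T (\<lambda>y. u y + (-1 * w y)) x = T u x + T (\<lambda>y. -1 * w y) x"
    using T[unfolded bounded_linear_L2_def, THEN conjunct2, THEN conjunct2, THEN conjunct1,
        THEN bspec, OF u, THEN bspec, OF m] .
  moreover have "AE x in lebesgue_on \<Omega>. T (\<lambda>y. -1 * w y) x = -1 * T w x"
    using T w unfolding bounded_linear_L2_def by blast
  ultimately show ?thesis by eventually_elim (simp add: fun_diff_def)
qed

text \<open>
  The linear term becomes a pairing of \<open>u - v\<close> with the adjoint applied to the residual at \<open>v\<close>.
  The quadratic term is what bounds the distance between a minimiser \<open>u\<close> and \<open>v\<close>.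
\<close>
lemma residual_expansion:
  assumes T: "bounded_linear_L2 \<Omega> T" and g: "g \<in> L2_space \<Omega>"
    and u: "u \<in> L2_space \<Omega>" and v: "v \<in> L2_space \<Omega>"
  shows "(L2_norm \<Omega> (T u - g))\<^sup>2 = (L2_norm \<Omega> (T v - g))\<^sup>2
    + 2 * L2_inner \<Omega> (T (u - v)) (T v - g) + (L2_norm \<Omega> (T (u - v)))\<^sup>2"
proof -
  have sp: "T u \<in> L2_space \<Omega>" "T v \<in> L2_space \<Omega>" "T (u - v) \<in> L2_space \<Omega>"
    using T u v L2_space_diff[OF u v] unfolding bounded_linear_L2_def by blast+
  have r: "T v - g \<in> L2_space \<Omega>" "T u - g \<in> L2_space \<Omega>" using sp g by (auto intro: L2_space_diff)
  have ae: "AE x in lebesgue_on \<Omega>. (T u - g) x = 1 * T (u - v) x + 1 * (T v - g) x"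
    using bounded_linear_L2_diff[OF T u v] by eventually_elim simp
  have "(L2_norm \<Omega> (T u - g))\<^sup>2 = (L2_norm \<Omega> (\<lambda>x. 1 * T (u - v) x + 1 * (T v - g) x))\<^sup>2"
    unfolding L2_norm_sq
    by (rule L2_inner_AE_cong) (use ae r L2_space_lin[OF sp(3) r(1), of 1 1] in auto)
  also have "\<dots> = (L2_norm \<Omega> (T v - g))\<^sup>2
    + 2 * L2_inner \<Omega> (T (u - v)) (T v - g) + (L2_norm \<Omega> (T (u - v)))\<^sup>2"
    unfolding L2_norm_sq_lin[OF sp(3) r(1)] by simp
  finally show ?thesis .
qed

section \<open>Functions of bounded variation\<close>

text \<open>
  The difference quotients of \<open>F\<close> in the direction \<open>h\<close> have integral zero because Lebesgue measure is
  translation invariant. They converge pointwise to the derivative, and the mean value theorem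
  bounds them by a constant on one fixed ball, outside which they vanish. Applied to a product, this
  is an integration by parts that needs no information on the boundary of the domain.
\<close>
lemma integral_directional_derivative_eq_0:
  fixes F :: "'a::euclidean_space \<Rightarrow> real"
  assumes dF: "\<And>x. (F has_derivative F' x) (at x)"
    and cont: "continuous_on UNIV (\<lambda>x. F' x h)"
    and bdd: "bounded {x. F x \<noteq> 0}"
  shows "integral\<^sup>L lborel (\<lambda>x. F' x h) = 0"
proof -
  have contF: "continuous_on UNIV F"
    using dF by (meson continuous_at_imp_continuous_on has_derivative_continuous)
  have [measurable]: "F \<in> borel_measurable borel" "(\<lambda>x. F' x h) \<in> borel_measurable borel"
    using contF cont by (auto intro: borel_measurable_continuous_onI)
  obtain R where R: "\<And>x. F x \<noteq> 0 \<Longrightarrow> norm x \<le> R"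
    using bdd by (auto simp: bounded_iff)
  \<comment> \<open>contains the supports of all the shifted functions, as the shifts have length at most \<open>norm h\<close>\<close>
  define B where "B = cball (0::'a) (R + norm h)"
  have "compact ((\<lambda>x. F' x h) ` cball 0 (R + 2 * norm h))"
    by (rule compact_continuous_image) (auto intro: continuous_on_subset[OF cont])
  then obtain C where C: "\<And>x. norm x \<le> R + 2 * norm h \<Longrightarrow> \<bar>F' x h\<bar> \<le> C"
    by (force dest: compact_imp_bounded simp: bounded_iff)
  define t where "t = (\<lambda>k. 1 / real (Suc k))"
  have t: "t k > 0" "t k \<le> 1" for k by (auto simp: t_def)
  define s where "s = (\<lambda>k x. (F (x + t k *\<^sub>R h) - F x) / t k)"
  have intF: "integrable lborel F"
  proof -
    have "integrable lborel (\<lambda>x. indicator (cball 0 R) x *\<^sub>R F x)"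
      by (rule borel_integrable_compact) (auto intro: continuous_on_subset[OF contF])
    moreover have "(\<lambda>x. indicator (cball 0 R) x *\<^sub>R F x) = F"
      using R by (fastforce simp: indicator_def)
    ultimately show ?thesis by simp
  qed
  have shift: "integrable lborel (\<lambda>x. F (x + c)) \<and> integral\<^sup>L lborel (\<lambda>x. F (x + c)) = integral\<^sup>L lborel F" for c
  proof -
    have "integrable (distr lborel borel ((+) c)) F" using intF by (simp add: lborel_distr_plus)
    then have "integrable lborel (\<lambda>x. F (c + x))" by (subst (asm) integrable_distr_eq) auto
    moreover have "integral\<^sup>L (distr lborel borel ((+) c)) F = integral\<^sup>L lborel (\<lambda>x. F (c + x))"
      by (rule integral_distr) auto
    ultimately show ?thesis by (simp add: lborel_distr_plus add.commute)
  qed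
  have s0: "integral\<^sup>L lborel (s k) = 0" for k
    unfolding s_def using shift[of "t k *\<^sub>R h"] intF by simp
  have conv: "(\<lambda>k. s k x) \<longlonglongrightarrow> F' x h" for x
  proof -
    have "((\<lambda>r. F (x + r *\<^sub>R h)) has_derivative (\<lambda>r. F' x (r *\<^sub>R h))) (at 0)"
      by (rule has_derivative_compose[where g=F and f="\<lambda>r. x + r *\<^sub>R h", simplified, of "\<lambda>r. r *\<^sub>R h", simplified])
         (auto intro!: derivative_eq_intros dF)
    moreover have "F' x (r *\<^sub>R h) = F' x h * r" for r
      using linear_scale[OF has_derivative_linear[OF dF[of x]]] by simp
    ultimately have "((\<lambda>r. F (x + r *\<^sub>R h)) has_real_derivative F' x h) (at 0)"
      by (simp add: has_field_derivative_def)
    then have *: "((\<lambda>r. (F (x + r *\<^sub>R h) - F x) / r) \<longlongrightarrow> F' x h) (at 0)"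
      by (simp add: DERIV_def)
    have "filterlim t (at 0) sequentially"
      unfolding filterlim_at using t(1) LIMSEQ_inverse_real_of_nat
      by (auto simp: t_def inverse_eq_divide intro!: eventuallyI)
    from filterlim_compose[OF * this] show ?thesis by (simp add: s_def)
  qed
  have bound: "\<bar>s k x\<bar> \<le> C * indicator B x" for k x
  proof (cases "x \<in> B")
    case True
    have "norm (F (x + t k *\<^sub>R h) - F x) \<le> norm (t k) * C"
    proof -
      have d: "((\<lambda>r. F (x + r *\<^sub>R h)) has_derivative (\<lambda>r. F' (x + y *\<^sub>R h) (r *\<^sub>R h))) (at y within {0..t k})" for y
        by (rule has_derivative_compose[where g=F and f="\<lambda>r. x + r *\<^sub>R h"])
           (auto intro!: derivative_eq_intros dF)
      obtain y where y: "y \<in> {0..t k}"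
        "F (x + t k *\<^sub>R h) - F (x + 0 *\<^sub>R h) = F' (x + y *\<^sub>R h) ((t k - 0) *\<^sub>R h)"
        using mvt_very_simple[of 0 "t k" "\<lambda>r. F (x + r *\<^sub>R h)" "\<lambda>y r. F' (x + y *\<^sub>R h) (r *\<^sub>R h)"] d t(1)[of k] by (auto simp: less_imp_le)
      have "norm (x + y *\<^sub>R h) \<le> norm x + \<bar>y\<bar> * norm h" using norm_triangle_ineq[of x "y *\<^sub>R h"] by simp
      also have "\<dots> \<le> (R + norm h) + 1 * norm h"
        using True y(1) t(2)[of k] by (intro add_mono mult_right_mono) (auto simp: B_def)
      finally have "\<bar>F' (x + y *\<^sub>R h) h\<bar> \<le> C" using C by simp
      moreover have "F' (x + y *\<^sub>R h) (t k *\<^sub>R h) = t k * F' (x + y *\<^sub>R h) h"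
        using linear_scale[OF has_derivative_linear[OF dF]] by simp
      ultimately show ?thesis using y(2) t(1)[of k] by (simp add: abs_mult)
    qed
    then show ?thesis using True t(1)[of k] by (simp add: s_def field_simps)
  next
    case False
    have "norm (x + t k *\<^sub>R h) \<ge> norm x - norm (t k *\<^sub>R h)" using norm_diff_ineq by blast
    moreover have "norm (t k *\<^sub>R h) \<le> norm h" using t[of k] by (simp add: mult_left_le_one_le)
    ultimately have "F (x + t k *\<^sub>R h) = 0" "F x = 0"
      using False R[of x] R[of "x + t k *\<^sub>R h"] norm_ge_zero[of h] unfolding B_def by force+
    then show ?thesis using False by (simp add: s_def)
  qed
  have "(\<lambda>k. integral\<^sup>L lborel (s k)) \<longlonglongrightarrow> integral\<^sup>L lborel (\<lambda>x. F' x h)"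
  proof (rule integral_dominated_convergence[where w="\<lambda>x. C * indicator B x"])
    show "integrable lborel (\<lambda>x. C * indicator B x)"
      unfolding B_def by (intro integrable_mult_right integrable_real_indicator) (use emeasure_bounded_finite[OF bounded_cball] in auto)
    show "\<And>k. s k \<in> borel_measurable lborel" unfolding s_def by measurable
  qed (use conv bound in auto)
  then show ?thesis using s0 by (simp add: LIMSEQ_const_iff)
qed

lemma integrable_lebesgue_on_continuous:
  fixes f :: "'a::euclidean_space \<Rightarrow> real"
  assumes "open \<Omega>" "bounded \<Omega>" and f: "continuous_on UNIV f"
  shows "integrable (lebesgue_on \<Omega>) f"
proof -
  interpret finite_measure "lebesgue_on \<Omega>"
    using assms(1,2) by (rule finite_measure_bounded_open)
  have "compact (f ` closure \<Omega>)"
    using assms(2) by (intro compact_continuous_image continuous_on_subset[OF f]) auto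
  then obtain B where B: "\<And>x. x \<in> \<Omega> \<Longrightarrow> \<bar>f x\<bar> \<le> B"
    using closure_subset[of \<Omega>] by (force dest: compact_imp_bounded simp: bounded_iff)
  have "f \<in> borel_measurable (lebesgue_on \<Omega>)"
    using assms by (intro continuous_imp_measurable_on_sets_lebesgue continuous_on_subset[OF f]) auto
  then show ?thesis using B by (intro integrable_const_bound[where B=B]) auto
qed

text \<open>
  Integrating by parts moves the divergence from \<open>q\<close> to \<open>u\<close>, and \<open>|q| \<le> 1\<close> bounds the result by the
  \<open>L\<^sup>1\<close> norms of the partial derivatives of \<open>u\<close>. Since \<open>q\<close> has compact support in \<open>\<Omega>\<close>,
  there is no boundary term, whatever the values of \<open>u\<close> there.
\<close>
lemma TV_finite_C1:
  fixes u :: "real^'n \<Rightarrow> real"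
  assumes \<Omega>: "open \<Omega>" "bounded \<Omega>"
    and du: "\<And>x. (u has_derivative u' x) (at x)"
    and cont: "\<And>h. continuous_on UNIV (\<lambda>x. u' x h)"
  shows "TV \<Omega> u < \<infinity>"
proof -
  let ?M = "lebesgue_on \<Omega>"
  define C where "C = (\<Sum>i\<in>UNIV. \<integral>x. \<bar>u' x (axis i 1)\<bar> \<partial>?M)"
  have contu: "continuous_on UNIV u"
    using du by (meson continuous_at_imp_continuous_on has_derivative_continuous)
  have "(\<integral>x. u x * divergence q x \<partial>?M) \<le> C"
    if q: "q \<in> C1c_fields \<Omega>" and q1: "AE x in ?M. norm (q x) \<le> 1" for q
  proof -
    define D where "D = (\<lambda>x. frechet_derivative q (at x))"
    have dq: "(q has_derivative D x) (at x)" for x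
      using q by (auto simp: C1c_fields_def D_def frechet_derivative_works)
    have contD: "continuous_on UNIV (\<lambda>x. D x h)" for h using q by (auto simp: C1c_fields_def D_def)
    have contq: "continuous_on UNIV q"
      using dq by (meson continuous_at_imp_continuous_on has_derivative_continuous)
    define K where "K = closure {x. q x \<noteq> 0}"
    have K: "compact K" "K \<subseteq> \<Omega>" using q by (auto simp: C1c_fields_def K_def)
    have q0: "q x = 0" if "x \<notin> K" for x using that closure_subset[of "{x. q x \<noteq> 0}"] by (auto simp: K_def)
    have D0: "D x h = 0" if "x \<notin> K" for x h
    proof -
      have "((\<lambda>x. 0) has_derivative (\<lambda>h. 0)) (at x)" by simp
      then have "(q has_derivative (\<lambda>h. 0)) (at x)"
        by (rule has_derivative_transform_within_open[where s="- K"])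
           (use K that q0 in \<open>auto simp: compact_imp_closed open_Compl\<close>)
      from has_derivative_unique[OF dq this] show ?thesis by simp
    qed
    have part: "(\<integral>x. u x * D x (axis i 1) $ i \<partial>?M) \<le> (\<integral>x. \<bar>u' x (axis i 1)\<bar> \<partial>?M)"
      and int: "integrable ?M (\<lambda>x. u x * D x (axis i 1) $ i)" for i
    proof -
      define h :: "real^'n" where "h = axis i 1"
      define F' where "F' = (\<lambda>x h. u x * D x h $ i + u' x h * q x $ i)"
      have dF: "((\<lambda>x. u x * q x $ i) has_derivative F' x) (at x)" for x
        unfolding F'_def
        by (rule derivative_eq_intros du bounded_linear.has_derivative[OF bounded_linear_vec_nth dq] refl)+
      have contF': "continuous_on UNIV (\<lambda>x. F' x h)"
        unfolding F'_def by (intro continuous_intros contu contD contq cont)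
      have "{x. u x * q x $ i \<noteq> 0} \<subseteq> K" using q0 by force
      then have "bounded {x. u x * q x $ i \<noteq> 0}" using K compact_imp_bounded bounded_subset by blast
      from integral_directional_derivative_eq_0[OF dF contF' this]
      \<comment> \<open>passing from the whole space to \<open>\<Omega>\<close> loses nothing, since \<open>q\<close> and its derivative vanish off \<open>K\<close>\<close>
      have "0 = integral\<^sup>L lborel (\<lambda>x. F' x h)" by simp
      also have "\<dots> = integral\<^sup>L lebesgue (\<lambda>x. F' x h)"
        using contF' by (intro integral_completion[symmetric]) (auto intro: borel_measurable_continuous_onI)
      also have "(\<lambda>x. F' x h) = (\<lambda>x. if x \<in> \<Omega> then F' x h else 0)"
        using q0 D0 K(2) by (fastforce simp: F'_def)
      also have "integral\<^sup>L lebesgue \<dots> = integral\<^sup>L ?M (\<lambda>x. F' x h)"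
        using \<Omega> by (intro Lebesgue_Measure.integral_restrict_UNIV) auto
      finally have z: "integral\<^sup>L ?M (\<lambda>x. F' x h) = 0" by simp
      have i1: "integrable ?M (\<lambda>x. u x * D x h $ i)" and i2: "integrable ?M (\<lambda>x. u' x h * q x $ i)"
        and i3: "integrable ?M (\<lambda>x. \<bar>u' x h\<bar>)"
        by (intro integrable_lebesgue_on_continuous \<Omega> continuous_intros contu contD contq cont)+
      then have "(\<integral>x. u x * D x h $ i \<partial>?M) = (\<integral>x. - (u' x h * q x $ i) \<partial>?M)"
        using z by (simp add: F'_def)
      also have "\<dots> \<le> (\<integral>x. \<bar>u' x h\<bar> \<partial>?M)"
      proof (rule integral_mono_AE)
        show "AE x in ?M. - (u' x h * q x $ i) \<le> \<bar>u' x h\<bar>"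
          using q1
        proof eventually_elim
          case (elim x)
          then have "\<bar>q x $ i\<bar> \<le> 1" using component_le_norm_cart[of "q x" i] by linarith
          then have "\<bar>u' x h\<bar> * \<bar>q x $ i\<bar> \<le> \<bar>u' x h\<bar>" by (simp add: mult_left_le)
          then show ?case unfolding abs_mult[symmetric] by linarith
        qed
      qed (use i2 i3 in auto)
      finally show "(\<integral>x. u x * D x (axis i 1) $ i \<partial>?M) \<le> (\<integral>x. \<bar>u' x (axis i 1)\<bar> \<partial>?M)"
        by (simp add: h_def)
      show "integrable ?M (\<lambda>x. u x * D x (axis i 1) $ i)" using i1 by (simp add: h_def)
    qed
    have "u x * divergence q x = (\<Sum>i\<in>UNIV. u x * D x (axis i 1) $ i)" for x
      by (simp add: divergence_def trace_def matrix_def D_def sum_distrib_left)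
    then have "(\<integral>x. u x * divergence q x \<partial>?M) = (\<Sum>i\<in>UNIV. \<integral>x. u x * D x (axis i 1) $ i \<partial>?M)"
      using int by simp
    also have "\<dots> \<le> C" unfolding C_def by (intro sum_mono part)
    finally show ?thesis .
  qed
  then have "TV \<Omega> u \<le> ereal C" unfolding TV_def by (intro SUP_least) auto
  then show ?thesis by (cases "TV \<Omega> u") auto
qed

lemma real_polynomial_function_C1:
  fixes p :: "'a::euclidean_space \<Rightarrow> real"
  assumes "real_polynomial_function p"
  shows "\<exists>p'. (\<forall>x. (p has_derivative p' x) (at x)) \<and> (\<forall>h. continuous_on UNIV (\<lambda>x. p' x h))"
  using assms
proof (induction rule: real_polynomial_function.induct)
  case (linear f)
  then show ?case by (intro exI[of _ "\<lambda>x. f"]) (auto intro: bounded_linear_imp_has_derivative)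
next
  case (const c)
  show ?case by (intro exI[of _ "\<lambda>x h. 0"]) auto
next
  case (add f g)
  then obtain f' g' where "\<forall>x. (f has_derivative f' x) (at x)" "\<forall>h. continuous_on UNIV (\<lambda>x. f' x h)"
    "\<forall>x. (g has_derivative g' x) (at x)" "\<forall>h. continuous_on UNIV (\<lambda>x. g' x h)" by blast
  then show ?case
    by (intro exI[of _ "\<lambda>x h. f' x h + g' x h"]) (auto intro!: continuous_intros derivative_intros)
next
  case (mult f g)
  then obtain f' g' where d: "\<And>x. (f has_derivative f' x) (at x)" "\<And>h. continuous_on UNIV (\<lambda>x. f' x h)"
    "\<And>x. (g has_derivative g' x) (at x)" "\<And>h. continuous_on UNIV (\<lambda>x. g' x h)" by blast
  have "continuous_on UNIV f" "continuous_on UNIV g"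
    using mult.hyps continuous_on_polymonial_function real_polynomial_function_eq by blast+
  with d show ?case
    by (intro exI[of _ "\<lambda>x h. f x * g' x h + f' x h * g x"]) (auto intro!: continuous_intros derivative_intros)
qed

lemma real_polynomial_function_BV:
  fixes p :: "real^'n \<Rightarrow> real"
  assumes "open \<Omega>" "bounded \<Omega>" "real_polynomial_function p"
  shows "p \<in> BV \<Omega>"
proof -
  obtain p' where p': "\<And>x. (p has_derivative p' x) (at x)" "\<And>h. continuous_on UNIV (\<lambda>x. p' x h)"
    using real_polynomial_function_C1[OF assms(3)] by blast
  have "continuous_on UNIV p"
    using p'(1) by (meson continuous_at_imp_continuous_on has_derivative_continuous)
  then have "p \<in> L1_space \<Omega>" using assms by (simp add: L1_space_def integrable_lebesgue_on_continuous)
  with TV_finite_C1[OF assms(1,2) p'] show ?thesis by (simp add: BV_def)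
qed

text \<open>
  The zero field is admissible.
\<close>
lemma TV_nonneg:
  fixes u :: "real^'n \<Rightarrow> real"
  shows "0 \<le> TV \<Omega> u"
proof -
  have "(\<lambda>x. 0) \<in> C1c_fields \<Omega>" by (simp add: C1c_fields_def)
  then have m: "(\<lambda>x. 0) \<in> {q \<in> C1c_fields \<Omega>. AE x in lebesgue_on \<Omega>. norm (q x) \<le> 1}" by simp
  have "divergence (\<lambda>x. 0) x = 0" for x :: "real^'n"
    by (simp add: divergence_def trace_def matrix_def)
  then have "ereal (\<integral>x. u x * divergence (\<lambda>x. 0) x \<partial>lebesgue_on \<Omega>) = 0" by simp
  with SUP_upper[OF m, of "\<lambda>q. ereal (\<integral>x. u x * divergence q x \<partial>lebesgue_on \<Omega>)"]
  show ?thesis unfolding TV_def by simp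
qed

section \<open>Density of polynomials\<close>

lemma L2_norm_tendsto_0_dominated:
  fixes f :: "nat \<Rightarrow> 'a::euclidean_space \<Rightarrow> real"
  assumes v: "v \<in> borel_measurable (lebesgue_on \<Omega>)"
    and f: "\<And>n. f n \<in> borel_measurable (lebesgue_on \<Omega>)"
    and w: "integrable (lebesgue_on \<Omega>) w"
    and conv: "AE x in lebesgue_on \<Omega>. (\<lambda>n. f n x) \<longlonglongrightarrow> v x"
    and bound: "\<And>n. AE x in lebesgue_on \<Omega>. (v x - f n x)\<^sup>2 \<le> w x"
  shows "(\<lambda>n. L2_norm \<Omega> (v - f n)) \<longlonglongrightarrow> 0"
proof -
  have "(\<lambda>n. L2_inner \<Omega> (v - f n) (v - f n)) \<longlonglongrightarrow> integral\<^sup>L (lebesgue_on \<Omega>) (\<lambda>x. 0)"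
    unfolding L2_inner_def
  proof (rule integral_dominated_convergence[OF _ _ w])
    show "AE x in lebesgue_on \<Omega>. (\<lambda>n. (v - f n) x * (v - f n) x) \<longlonglongrightarrow> 0"
      using conv
    proof eventually_elim
      case (elim x)
      have "(\<lambda>n. (v x - f n x) * (v x - f n x)) \<longlonglongrightarrow> (v x - v x) * (v x - v x)"
        by (intro tendsto_intros elim)
      then show ?case by simp
    qed
    show "AE x in lebesgue_on \<Omega>. norm ((v - f n) x * (v - f n) x) \<le> w x" for n
      using bound[of n] by eventually_elim (simp add: power2_eq_square)
  qed (use v f in \<open>auto simp: fun_diff_def\<close>)
  then have "(\<lambda>n. sqrt (L2_inner \<Omega> (v - f n) (v - f n))) \<longlonglongrightarrow> sqrt 0"
    by (intro tendsto_real_sqrt) simp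
  then show ?thesis by (simp add: L2_norm_def)
qed

definition clamp_abs :: "real \<Rightarrow> real \<Rightarrow> real" where
  "clamp_abs M y = max (- M) (min M y)"

lemma clamp_abs_le: "0 \<le> M \<Longrightarrow> \<bar>clamp_abs M y\<bar> \<le> M"
  by (auto simp: clamp_abs_def)

lemma L2_space_bounded:
  assumes "open \<Omega>" "bounded \<Omega>" "u \<in> borel_measurable (lebesgue_on \<Omega>)" "\<And>x. \<bar>u x\<bar> \<le> B"
  shows "u \<in> L2_space \<Omega>"
proof -
  interpret finite_measure "lebesgue_on \<Omega>" using assms(1,2) by (rule finite_measure_bounded_open)
  have "(u x)\<^sup>2 \<le> B\<^sup>2" for x using assms(4)[of x] power_mono[of "\<bar>u x\<bar>" B 2] by simp
  then have "integrable (lebesgue_on \<Omega>) (\<lambda>x. (u x)\<^sup>2)"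
    using assms(3) by (intro integrable_const_bound[where B="B\<^sup>2"]) auto
  with assms(3) show ?thesis by (simp add: L2_space_def)
qed

lemma L2_norm_triangle_diff:
  assumes "u \<in> L2_space \<Omega>" "w \<in> L2_space \<Omega>" "z \<in> L2_space \<Omega>"
  shows "L2_norm \<Omega> (u - z) \<le> L2_norm \<Omega> (u - w) + L2_norm \<Omega> (w - z)"
  using L2_norm_triangle[OF L2_space_diff[OF assms(1,2)] L2_space_diff[OF assms(2,3)]]
  by (simp add: fun_diff_def)

text \<open>
  Truncation makes the function bounded, so that a constant can serve as the integrable majorant for
  the approximation by continuous functions that follows.
\<close>
lemma L2_approx_clamp:
  assumes \<Omega>: "open \<Omega>" "bounded \<Omega>" and v: "v \<in> L2_space \<Omega>" and e: "0 < e"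
  shows "\<exists>M\<ge>0. L2_norm \<Omega> (v - (\<lambda>x. clamp_abs M (v x))) < e"
proof -
  have m: "v \<in> borel_measurable (lebesgue_on \<Omega>)" using v by (simp add: L2_space_def)
  have "(\<lambda>n. L2_norm \<Omega> (v - (\<lambda>x. clamp_abs (real n) (v x)))) \<longlonglongrightarrow> 0"
  proof (rule L2_norm_tendsto_0_dominated[where w="\<lambda>x. (v x)\<^sup>2"])
    have "(\<lambda>n. clamp_abs (real n) (v x)) \<longlonglongrightarrow> v x" for x
    proof (rule tendsto_eventually)
      have "eventually (\<lambda>n. \<bar>v x\<bar> \<le> real n) sequentially"
        using eventually_ge_at_top[of "nat \<lceil>\<bar>v x\<bar>\<rceil>"] by eventually_elim linarith
      then show "eventually (\<lambda>n. clamp_abs (real n) (v x) = v x) sequentially"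
        by eventually_elim (auto simp: clamp_abs_def)
    qed
    then show "AE x in lebesgue_on \<Omega>. (\<lambda>n. clamp_abs (real n) (v x)) \<longlonglongrightarrow> v x" by simp
    show "AE x in lebesgue_on \<Omega>. (v x - clamp_abs (real n) (v x))\<^sup>2 \<le> (v x)\<^sup>2" for n
    proof (rule AE_I2)
      fix x
      have "\<bar>v x - clamp_abs (real n) (v x)\<bar> \<le> \<bar>v x\<bar>" by (auto simp: clamp_abs_def)
      then show "(v x - clamp_abs (real n) (v x))\<^sup>2 \<le> (v x)\<^sup>2" by (simp only: abs_le_square_iff)
    qed
  qed (use v m in \<open>auto simp: L2_space_def clamp_abs_def\<close>)
  from order_tendstoD(2)[OF this e] obtain n where
    "L2_norm \<Omega> (v - (\<lambda>x. clamp_abs (real n) (v x))) < e"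
    by (auto simp: eventually_sequentially)
  then show ?thesis by (intro exI[of _ "real n"]) simp
qed

text \<open>
  A Lebesgue measurable function is an almost everywhere limit of continuous functions, but without
  any domination. Truncating both the function and its approximants at the same height \<open>M\<close> supplies
  it, as \<open>\<Omega>\<close> has finite measure.
\<close>
lemma L2_approx_continuous:
  assumes \<Omega>: "open \<Omega>" "bounded \<Omega>" and v: "v \<in> L2_space \<Omega>" and e: "0 < e"
  shows "\<exists>f\<in>L2_space \<Omega>. continuous_on UNIV f \<and> L2_norm \<Omega> (v - f) < e"
proof -
  let ?L = "lebesgue_on \<Omega>"
  interpret finite_measure ?L using \<Omega> by (rule finite_measure_bounded_open)
  obtain M where M: "M \<ge> 0" "L2_norm \<Omega> (v - (\<lambda>x. clamp_abs M (v x))) < e / 2"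
    using L2_approx_clamp[OF \<Omega> v, of "e / 2"] e by auto
  define w where "w = (\<lambda>x. clamp_abs M (v x))"
  have m: "v \<in> borel_measurable ?L" using v by (simp add: L2_space_def)
  then have mw: "w \<in> borel_measurable ?L" unfolding w_def clamp_abs_def by measurable
  have wb: "\<bar>w x\<bar> \<le> M" for x using M by (simp add: w_def clamp_abs_le)
  have \<Omega>s: "\<Omega> \<in> sets lebesgue" using \<Omega> by auto
  have "v measurable_on \<Omega>" using m by (simp add: measurable_on_iff_borel_measurable \<Omega>s)
  then obtain N g where N: "negligible N" and g: "\<And>n. continuous_on UNIV (g n)"
    and lim: "\<And>x. x \<notin> N \<Longrightarrow> (\<lambda>n. g n x) \<longlonglongrightarrow> (if x \<in> \<Omega> then v x else 0)"
    unfolding measurable_on_def by blast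
  define f where "f = (\<lambda>n x. clamp_abs M (g n x))"
  have fc: "continuous_on UNIV (f n)" for n
    unfolding f_def clamp_abs_def by (intro continuous_intros g)
  have mf: "f n \<in> borel_measurable ?L" for n
    by (intro continuous_imp_measurable_on_sets_lebesgue \<Omega>s continuous_on_subset[OF fc]) auto
  have fb: "\<bar>f n x\<bar> \<le> M" for n x using M by (simp add: f_def clamp_abs_le)
  have "(\<lambda>n. L2_norm \<Omega> (w - f n)) \<longlonglongrightarrow> 0"
  proof (rule L2_norm_tendsto_0_dominated[where w="\<lambda>x. (2 * M)\<^sup>2"])
    have "AE x in lebesgue. x \<notin> N" using N by (simp add: negligible_iff_null_sets AE_not_in)
    then have "AE x in ?L. x \<notin> N" using \<Omega>s by (auto simp: AE_restrict_space_iff elim: eventually_mono)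
    moreover have "AE x in ?L. x \<in> \<Omega>" using AE_space[of ?L] by simp
    ultimately show "AE x in ?L. (\<lambda>n. f n x) \<longlonglongrightarrow> w x"
    proof eventually_elim
      case (elim x)
      with lim[of x] show ?case
        unfolding f_def w_def clamp_abs_def by (intro tendsto_intros) auto
    qed
    have "\<bar>w x - f n x\<bar> \<le> \<bar>2 * M\<bar>" for n x using wb[of x] fb[of n x] by linarith
    then show "AE x in ?L. (w x - f n x)\<^sup>2 \<le> (2 * M)\<^sup>2" for n
      by (intro AE_I2) (simp only: abs_le_square_iff)
  qed (use mw mf in auto)
  from order_tendstoD(2)[OF this, of "e / 2"] e obtain n where n: "L2_norm \<Omega> (w - f n) < e / 2"
    by (auto simp: eventually_sequentially)
  have L: "w \<in> L2_space \<Omega>" "f n \<in> L2_space \<Omega>"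
    using L2_space_bounded[OF \<Omega> mw wb] L2_space_bounded[OF \<Omega> mf fb] by auto
  have "L2_norm \<Omega> (v - f n) < e"
    using L2_norm_triangle_diff[OF v L] M(2) n by (simp add: w_def)
  with L fc show ?thesis by blast
qed

text \<open>
  Polynomials are dense by the Weierstrass theorem on the compact closure of \<open>\<Omega>\<close>. They are a
  convenient dense class here because they lie in \<open>BV \<Omega>\<close>.
\<close>
lemma L2_approx_polynomial:
  assumes \<Omega>: "open \<Omega>" "bounded \<Omega>" and v: "v \<in> L2_space \<Omega>" and e: "0 < e"
  shows "\<exists>p\<in>L2_space \<Omega>. real_polynomial_function p \<and> L2_norm \<Omega> (v - p) < e"
proof -
  let ?L = "lebesgue_on \<Omega>"
  interpret finite_measure ?L using \<Omega> by (rule finite_measure_bounded_open)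
  obtain f where f: "f \<in> L2_space \<Omega>" "continuous_on UNIV f" "L2_norm \<Omega> (v - f) < e / 2"
    using L2_approx_continuous[OF \<Omega> v, of "e / 2"] e by auto
  define k where "k = L2_norm \<Omega> (\<lambda>x. 1)"
  \<comment> \<open>\<open>k\<close> is the square root of the measure of \<open>\<Omega>\<close>; adding 1 keeps the denominator positive\<close>
  define d where "d = e / (2 * (k + 1))"
  have k: "k \<ge> 0" by (simp add: k_def L2_norm_nonneg)
  with e have d: "d > 0" by (simp add: d_def)
  obtain p where p: "real_polynomial_function p" "\<And>x. x \<in> closure \<Omega> \<Longrightarrow> \<bar>f x - p x\<bar> < d"
    using Stone_Weierstrass_real_polynomial_function[of "closure \<Omega>" f d] d \<Omega>(2)
      continuous_on_subset[OF f(2)] by auto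
  have "continuous_on UNIV p"
    using p(1) continuous_on_polymonial_function real_polynomial_function_eq by blast
  then have pL: "p \<in> L2_space \<Omega>"
    using integrable_lebesgue_on_continuous[OF \<Omega>, of p] integrable_lebesgue_on_continuous[OF \<Omega>, of "\<lambda>x. (p x)\<^sup>2"]
    by (auto simp: L2_space_def intro!: continuous_intros)
  have "(L2_norm \<Omega> (f - p))\<^sup>2 \<le> (d * k)\<^sup>2"
  proof -
    have "(L2_norm \<Omega> (f - p))\<^sup>2 \<le> (\<integral>x. d\<^sup>2 * (1 * 1) \<partial>?L)"
      unfolding L2_norm_sq L2_inner_def
    proof (rule integral_mono)
      show "integrable ?L (\<lambda>x. (f - p) x * (f - p) x)"
        using L2_space_diff[OF f(1) pL] by (rule L2_space_integrable_mult[OF _ L2_space_diff[OF f(1) pL]])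
      show "(f - p) x * (f - p) x \<le> d\<^sup>2 * (1 * 1)" if "x \<in> space ?L" for x
      proof -
        have "\<bar>f x - p x\<bar> \<le> \<bar>d\<bar>" using that p(2)[of x] closure_subset[of \<Omega>] by auto
        then show ?thesis by (simp add: abs_le_square_iff flip: power2_eq_square)
      qed
    qed auto
    also have "\<dots> = d\<^sup>2 * k\<^sup>2" unfolding k_def L2_norm_sq L2_inner_def by simp
    finally show ?thesis by (simp add: power_mult_distrib)
  qed
  then have "L2_norm \<Omega> (f - p) \<le> d * k" by (rule power2_le_imp_le) (use d k in simp)
  also have "d * k < e / 2" using k e by (simp add: d_def field_simps)
  finally have "L2_norm \<Omega> (v - p) < e" using L2_norm_triangle_diff[OF v f(1) pL] f(3) by linarith
  with p(1) pL show ?thesis by blast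
qed

section \<open>Comparing the minimiser with an arbitrary point\<close>

text \<open>
  Upper semicontinuity of the data term at \<open>v\<close>, with an explicit modulus. One inequality is enough,
  since it is only used to let values at \<open>u\<close> that are bounded below pass to the limit \<open>v\<close>.
\<close>
lemma fidelity_upper_bound:
  assumes \<Omega>: "open \<Omega>" "bounded \<Omega>"
    and T: "bounded_linear_L2 \<Omega> T" and g: "g \<in> L2_space \<Omega>"
    and v: "v \<in> L2_space \<Omega>" and "\<alpha>1 \<ge> 0" "\<alpha>2 \<ge> 0"
  shows "\<exists>a b. \<forall>u\<in>L2_space \<Omega>. \<alpha>1 * L1_norm \<Omega> (T u - g) + \<alpha>2 * (L2_norm \<Omega> (T u - g))\<^sup>2
    \<le> \<alpha>1 * L1_norm \<Omega> (T v - g) + \<alpha>2 * (L2_norm \<Omega> (T v - g))\<^sup>2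
      + a * L2_norm \<Omega> (u - v) + b * (L2_norm \<Omega> (u - v))\<^sup>2"
proof -
  obtain C where C: "\<And>u. u \<in> L2_space \<Omega> \<Longrightarrow> L2_norm \<Omega> (T u) \<le> C * L2_norm \<Omega> u"
    using T unfolding bounded_linear_L2_def by blast
  define k where "k = L2_norm \<Omega> (\<lambda>x. 1)"
  define r where "r = L2_norm \<Omega> (T v - g)"
  show ?thesis
  proof (intro exI ballI)
    fix u assume u: "u \<in> L2_space \<Omega>"
    define d where "d = L2_norm \<Omega> (u - v)"
    have uv: "u - v \<in> L2_space \<Omega>" using u v by (rule L2_space_diff)
    have sp: "T u \<in> L2_space \<Omega>" "T v \<in> L2_space \<Omega>" "T (u - v) \<in> L2_space \<Omega>"
      using T u v uv unfolding bounded_linear_L2_def by blast+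
    then have R: "T v - g \<in> L2_space \<Omega>" "T u - g \<in> L2_space \<Omega>" using g by (auto intro: L2_space_diff)
    have n: "L2_norm \<Omega> (T (u - v)) \<le> C * d" using C[OF uv] by (simp add: d_def)
    have "L1_norm \<Omega> (T u - g) = L1_norm \<Omega> (\<lambda>x. T (u - v) x + (T v - g) x)"
      unfolding L1_norm_def
    proof (rule integral_cong_AE)
      show "AE x in lebesgue_on \<Omega>. \<bar>(T u - g) x\<bar> = \<bar>T (u - v) x + (T v - g) x\<bar>"
        using bounded_linear_L2_diff[OF T u v] by eventually_elim simp
    qed (use sp g in \<open>auto simp: L2_space_def\<close>)
    also have "\<dots> \<le> L1_norm \<Omega> (T (u - v)) + L1_norm \<Omega> (T v - g)"
      by (rule L1_norm_triangle[OF \<Omega> sp(3) R(1)])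
    also have "\<dots> \<le> k * (C * d) + L1_norm \<Omega> (T v - g)"
      using L1_norm_le_L2_norm[OF \<Omega> sp(3)] mult_left_mono[OF n, of k] L2_norm_nonneg[of \<Omega> "\<lambda>x. 1"]
      by (simp add: k_def)
    finally have 1: "\<alpha>1 * L1_norm \<Omega> (T u - g) \<le> \<alpha>1 * (k * (C * d) + L1_norm \<Omega> (T v - g))"
      using \<open>\<alpha>1 \<ge> 0\<close> by (rule mult_left_mono)
    have "L2_inner \<Omega> (T (u - v)) (T v - g) \<le> C * d * r"
      using L2_Cauchy_Schwarz[OF sp(3) R(1)] mult_right_mono[OF n, of r] L2_norm_nonneg[of \<Omega> "T v - g"]
      by (simp add: r_def)
    moreover have "(L2_norm \<Omega> (T (u - v)))\<^sup>2 \<le> (C * d)\<^sup>2"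
      by (rule power_mono[OF n L2_norm_nonneg])
    ultimately have "(L2_norm \<Omega> (T u - g))\<^sup>2 \<le> r\<^sup>2 + 2 * (C * d * r) + (C * d)\<^sup>2"
      using residual_expansion[OF T g u v] by (simp add: r_def)
    then have 2: "\<alpha>2 * (L2_norm \<Omega> (T u - g))\<^sup>2 \<le> \<alpha>2 * (r\<^sup>2 + 2 * (C * d * r) + (C * d)\<^sup>2)"
      using \<open>\<alpha>2 \<ge> 0\<close> by (rule mult_left_mono)
    show "\<alpha>1 * L1_norm \<Omega> (T u - g) + \<alpha>2 * (L2_norm \<Omega> (T u - g))\<^sup>2
      \<le> \<alpha>1 * L1_norm \<Omega> (T v - g) + \<alpha>2 * (L2_norm \<Omega> (T v - g))\<^sup>2
        + (\<alpha>1 * k * C + 2 * \<alpha>2 * C * r) * L2_norm \<Omega> (u - v) + (\<alpha>2 * C\<^sup>2) * (L2_norm \<Omega> (u - v))\<^sup>2"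
      using 1 2 unfolding d_def[symmetric] r_def[symmetric]
      by (simp add: algebra_simps power_mult_distrib)
  qed
qed

lemma minimal_on_BV_imp_minimal_on_L2:
  fixes v :: "real^'n \<Rightarrow> real"
  assumes \<Omega>: "open \<Omega>" "bounded \<Omega>"
    and T: "bounded_linear_L2 \<Omega> T" and g: "g \<in> L2_space \<Omega>"
    and v: "v \<in> L2_space \<Omega>" and \<alpha>: "\<alpha>1 \<ge> 0" "\<alpha>2 \<ge> 0"
    and min: "\<And>u. u \<in> BV \<Omega> \<inter> L2_space \<Omega> \<Longrightarrow>
      m \<le> \<alpha>1 * L1_norm \<Omega> (T u - g) + \<alpha>2 * (L2_norm \<Omega> (T u - g))\<^sup>2"
  shows "m \<le> \<alpha>1 * L1_norm \<Omega> (T v - g) + \<alpha>2 * (L2_norm \<Omega> (T v - g))\<^sup>2"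
proof -
  let ?J = "\<lambda>u. \<alpha>1 * L1_norm \<Omega> (T u - g) + \<alpha>2 * (L2_norm \<Omega> (T u - g))\<^sup>2"
  obtain a b where ab: "\<And>u. u \<in> L2_space \<Omega> \<Longrightarrow>
      ?J u \<le> ?J v + a * L2_norm \<Omega> (u - v) + b * (L2_norm \<Omega> (u - v))\<^sup>2"
    using fidelity_upper_bound[OF \<Omega> T g v \<alpha>] by blast
  have "\<exists>p. p \<in> L2_space \<Omega> \<and> real_polynomial_function p \<and> L2_norm \<Omega> (v - p) < inverse (real (Suc n))" for n
    using L2_approx_polynomial[OF \<Omega> v, of "inverse (real (Suc n))"] by auto
  then obtain p where p: "\<And>n. p n \<in> L2_space \<Omega>" "\<And>n. real_polynomial_function (p n)"
    "\<And>n. L2_norm \<Omega> (v - p n) < inverse (real (Suc n))" by metis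
  have sym: "L2_norm \<Omega> (p n - v) = L2_norm \<Omega> (v - p n)" for n
    by (simp add: L2_norm_def L2_inner_def algebra_simps)
  have d0: "(\<lambda>n. L2_norm \<Omega> (p n - v)) \<longlonglongrightarrow> 0"
    using LIMSEQ_inverse_real_of_nat
    by (rule tendsto_sandwich[OF _ _ tendsto_const, rotated 2])
       (use p(3) L2_norm_nonneg in \<open>auto simp: sym less_imp_le intro!: eventuallyI\<close>)
  have "(\<lambda>n. ?J v + a * L2_norm \<Omega> (p n - v) + b * (L2_norm \<Omega> (p n - v))\<^sup>2) \<longlonglongrightarrow> ?J v + a * 0 + b * 0\<^sup>2"
    by (intro tendsto_intros d0)
  moreover have "m \<le> ?J v + a * L2_norm \<Omega> (p n - v) + b * (L2_norm \<Omega> (p n - v))\<^sup>2" for n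
    using min[of "p n"] ab[OF p(1)[of n]] p(1)[of n] real_polynomial_function_BV[OF \<Omega> p(2)[of n]]
    by (meson IntI order_trans)
  ultimately have "m \<le> ?J v + a * 0 + b * 0\<^sup>2"
    by (intro LIMSEQ_le_const) auto
  then show ?thesis by simp
qed

text \<open>
  If \<open>lam > 0\<close>, finiteness of \<open>G\<close> at \<open>v\<close> forces \<open>v\<close> to be of bounded variation, so \<open>v\<close> is a competitor.
  If \<open>lam = 0\<close>, then \<open>v\<close> may have infinite total variation. The functional is then the data term
  alone, and the comparison follows from density.
\<close>
lemma minimiser_le:
  fixes v :: "real^'n \<Rightarrow> real"
  assumes \<Omega>: "open \<Omega>" "bounded \<Omega>"
    and T: "bounded_linear_L2 \<Omega> T" and g: "g \<in> L2_space \<Omega>"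
    and \<alpha>: "\<alpha>1 \<ge> 0" "\<alpha>2 \<ge> 0" and lam: "lam \<ge> 0"
    and min: "is_arg_min (E_functional \<Omega> T g \<alpha>1 \<alpha>2 lam) (\<lambda>u. u \<in> BV \<Omega> \<inter> L2_space \<Omega>) ustar"
    and v: "v \<in> L2_space \<Omega>" and fin: "G_functional \<Omega> T g \<alpha>1 lam v \<noteq> \<infinity>"
  shows "E_functional \<Omega> T g \<alpha>1 \<alpha>2 lam ustar \<le> E_functional \<Omega> T g \<alpha>1 \<alpha>2 lam v"
proof (cases "lam = 0")
  case True
  have E: "E_functional \<Omega> T g \<alpha>1 \<alpha>2 lam u
    = ereal (\<alpha>1 * L1_norm \<Omega> (T u - g) + \<alpha>2 * (L2_norm \<Omega> (T u - g))\<^sup>2)" for u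
  proof -
    have reg: "ereal lam * TV \<Omega> u = 0" unfolding True zero_ereal_def[symmetric] by simp
    show ?thesis unfolding E_functional_def reg by simp
  qed
  show ?thesis unfolding E ereal_less_eq
  proof (rule minimal_on_BV_imp_minimal_on_L2[OF \<Omega> T g v \<alpha>])
    fix u assume "u \<in> BV \<Omega> \<inter> L2_space \<Omega>"
    then have "E_functional \<Omega> T g \<alpha>1 \<alpha>2 lam ustar \<le> E_functional \<Omega> T g \<alpha>1 \<alpha>2 lam u"
      using min unfolding is_arg_min_def by (meson not_le)
    then show "\<alpha>1 * L1_norm \<Omega> (T ustar - g) + \<alpha>2 * (L2_norm \<Omega> (T ustar - g))\<^sup>2
      \<le> \<alpha>1 * L1_norm \<Omega> (T u - g) + \<alpha>2 * (L2_norm \<Omega> (T u - g))\<^sup>2"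
      unfolding E by simp
  qed
next
  case False
  with lam fin have "TV \<Omega> v < \<infinity>" by (cases "TV \<Omega> v") (auto simp: G_functional_def)
  then have "v \<in> BV \<Omega> \<inter> L2_space \<Omega>"
    using v L2_space_integrable[OF \<Omega> v] by (simp add: BV_def L1_space_def)
  with min show ?thesis unfolding is_arg_min_def by (meson not_le)
qed

section \<open>The estimates\<close>

text \<open>
  The subgradient inequality bounds \<open>\<langle>\<xi>, u\<^sup>* - v\<rangle>\<close> by \<open>G u\<^sup>* - G v\<close>, and minimality bounds the latter by a
  difference of squared residuals. Expanding this difference at \<open>v\<close> leaves one good quadratic term
  and two pairings with \<open>u\<^sup>* - v\<close>, which the Cauchy--Schwarz inequality controls.
\<close>
lemma subgradient_estimate:
  fixes v :: "real^'n \<Rightarrow> real"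
  assumes \<Omega>: "open \<Omega>" "bounded \<Omega>"
    and T: "bounded_linear_L2 \<Omega> T" and adj: "is_adjoint_L2 \<Omega> T Tadj" and g: "g \<in> L2_space \<Omega>"
    and \<alpha>: "\<alpha>1 \<ge> 0" "\<alpha>2 \<ge> 0" and lam: "lam \<ge> 0"
    and min: "is_arg_min (E_functional \<Omega> T g \<alpha>1 \<alpha>2 lam) (\<lambda>u. u \<in> BV \<Omega> \<inter> L2_space \<Omega>) ustar"
    and v: "v \<in> L2_space \<Omega>" and \<xi>: "\<xi> \<in> subdifferential_L2 \<Omega> (G_functional \<Omega> T g \<alpha>1 lam) v"
  shows "\<alpha>2 * (L2_norm \<Omega> (T (ustar - v)))\<^sup>2
    \<le> (2 * \<alpha>2 * L2_norm \<Omega> (Tadj (T v - g)) + L2_norm \<Omega> \<xi>) * L2_norm \<Omega> (ustar - v)"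
proof -
  let ?w = "ustar - v"
  let ?r = "T v - g"
  have u: "ustar \<in> L2_space \<Omega>" "TV \<Omega> ustar < \<infinity>"
    using min by (auto simp: is_arg_min_def BV_def)
  have fin: "G_functional \<Omega> T g \<alpha>1 lam v \<noteq> \<infinity>" and \<xi>L: "\<xi> \<in> L2_space \<Omega>"
    and sub: "ereal (L2_inner \<Omega> \<xi> ?w) + G_functional \<Omega> T g \<alpha>1 lam v \<le> G_functional \<Omega> T g \<alpha>1 lam ustar"
    using \<xi> u(1) by (auto simp: subdifferential_L2_def split: if_splits)
  have w: "?w \<in> L2_space \<Omega>" using u(1) v by (rule L2_space_diff)
  have r: "?r \<in> L2_space \<Omega>" using T v g by (auto simp: bounded_linear_L2_def intro: L2_space_diff)
  have Tr: "Tadj ?r \<in> L2_space \<Omega>" using adj r by (simp add: is_adjoint_L2_def)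
  \<comment> \<open>both regularisation terms are finite, so the two inequalities can be added in the reals\<close>
  obtain tu where tu: "ereal lam * TV \<Omega> ustar = ereal tu"
    using u(2) TV_nonneg[of \<Omega> ustar] by (cases "TV \<Omega> ustar") auto
  obtain tv where tv: "ereal lam * TV \<Omega> v = ereal tv"
    using fin lam TV_nonneg[of \<Omega> v] by (cases "TV \<Omega> v"; cases "lam = 0") (auto simp: G_functional_def)
  have "\<alpha>1 * L1_norm \<Omega> (T ustar - g) + \<alpha>2 * (L2_norm \<Omega> (T ustar - g))\<^sup>2 + tu
    \<le> \<alpha>1 * L1_norm \<Omega> (T v - g) + \<alpha>2 * (L2_norm \<Omega> ?r)\<^sup>2 + tv"
    using minimiser_le[OF \<Omega> T g \<alpha> lam min v fin] by (simp add: E_functional_def tu tv)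
  moreover have "L2_inner \<Omega> \<xi> ?w + (\<alpha>1 * L1_norm \<Omega> (T v - g) + tv) \<le> \<alpha>1 * L1_norm \<Omega> (T ustar - g) + tu"
    using sub by (simp add: G_functional_def tu tv)
  ultimately have "L2_inner \<Omega> \<xi> ?w \<le> \<alpha>2 * (L2_norm \<Omega> ?r)\<^sup>2 - \<alpha>2 * (L2_norm \<Omega> (T ustar - g))\<^sup>2" by linarith
  also have "\<dots> = - 2 * \<alpha>2 * L2_inner \<Omega> ?w (Tadj ?r) - \<alpha>2 * (L2_norm \<Omega> (T ?w))\<^sup>2"
    using adj w r unfolding residual_expansion[OF T g u(1) v]
    by (simp add: is_adjoint_L2_def algebra_simps)
  finally have "\<alpha>2 * (L2_norm \<Omega> (T ?w))\<^sup>2 \<le> 2 * \<alpha>2 * (- L2_inner \<Omega> ?w (Tadj ?r)) - L2_inner \<Omega> \<xi> ?w" by simp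
  also have "\<dots> \<le> 2 * \<alpha>2 * (L2_norm \<Omega> ?w * L2_norm \<Omega> (Tadj ?r)) + L2_norm \<Omega> \<xi> * L2_norm \<Omega> ?w"
  proof -
    have "2 * \<alpha>2 * (- L2_inner \<Omega> ?w (Tadj ?r)) \<le> 2 * \<alpha>2 * (L2_norm \<Omega> ?w * L2_norm \<Omega> (Tadj ?r))"
      using L2_Cauchy_Schwarz[OF w Tr] \<alpha>(2) by (intro mult_left_mono) auto
    then show ?thesis using L2_Cauchy_Schwarz[OF \<xi>L w] by linarith
  qed
  finally show ?thesis by (simp add: algebra_simps)
qed

theorem mainTheorem4:
  fixes \<Omega> :: "(real^'n) set"
    and T Tadj :: "(real^'n \<Rightarrow> real) \<Rightarrow> (real^'n \<Rightarrow> real)"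
    and g ustar v \<xi>G :: "real^'n \<Rightarrow> real"
    and \<alpha>1 \<alpha>2 lam :: real
  assumes "CARD('n) \<in> {1, 2}"
    and "open \<Omega>" and "\<Omega> \<noteq> {}" and "bounded \<Omega>" and "simply_connected \<Omega>"
    and "lipschitz_boundary \<Omega>"
    and "bounded_linear_L2 \<Omega> T" and "is_adjoint_L2 \<Omega> T Tadj"
    and "g \<in> L2_space \<Omega>"
    and "\<alpha>1 \<ge> 0" and "\<alpha>2 \<ge> 0" and "lam \<ge> 0"
    and "is_arg_min (E_functional \<Omega> T g \<alpha>1 \<alpha>2 lam) (\<lambda>u. u \<in> BV \<Omega> \<inter> L2_space \<Omega>) ustar"
    and "v \<in> L2_space \<Omega>"
    and "\<xi>G \<in> subdifferential_L2 \<Omega> (G_functional \<Omega> T g \<alpha>1 lam) v"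
  shows "(\<not> (AE x in lebesgue_on \<Omega>. v x = ustar x) \<longrightarrow>
            \<alpha>2 * ((L2_norm \<Omega> (T (ustar - v)))\<^sup>2 / L2_norm \<Omega> (ustar - v))
              \<le> 2 * \<alpha>2 * L2_norm \<Omega> (Tadj (T v - g)) + L2_norm \<Omega> \<xi>G) \<and>
         (\<forall>c>0. (\<forall>u\<in>L2_space \<Omega>. \<alpha>2 * (L2_norm \<Omega> (T u))\<^sup>2 \<ge> c * (L2_norm \<Omega> u)\<^sup>2) \<longrightarrow>
            c * L2_norm \<Omega> (ustar - v)
              \<le> 2 * \<alpha>2 * L2_norm \<Omega> (Tadj (T v - g)) + L2_norm \<Omega> \<xi>G)"
proof -
  define n where "n = L2_norm \<Omega> (ustar - v)"
  define b where "b = 2 * \<alpha>2 * L2_norm \<Omega> (Tadj (T v - g)) + L2_norm \<Omega> \<xi>G"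
  have key: "\<alpha>2 * (L2_norm \<Omega> (T (ustar - v)))\<^sup>2 \<le> b * n"
    unfolding n_def b_def using assms by (intro subgradient_estimate) auto
  have n: "0 \<le> n" by (simp add: n_def L2_norm_nonneg)
  have b: "0 \<le> b" using assms by (simp add: b_def L2_norm_nonneg)
  have ustar: "ustar \<in> L2_space \<Omega>" using assms by (simp add: is_arg_min_def)
  \<comment> \<open>for \<open>n = 0\<close> the quotient is \<open>0\<close> by convention, and \<open>b\<close> is nonnegative\<close>
  have "\<alpha>2 * ((L2_norm \<Omega> (T (ustar - v)))\<^sup>2 / n) \<le> b"
    using key n b by (cases "n = 0") (auto simp: field_simps)
  moreover have "c * n \<le> b"
    if "\<forall>u\<in>L2_space \<Omega>. c * (L2_norm \<Omega> u)\<^sup>2 \<le> \<alpha>2 * (L2_norm \<Omega> (T u))\<^sup>2" for c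
  proof -
    have "c * n\<^sup>2 \<le> b * n"
      using key that L2_space_diff[OF ustar \<open>v \<in> L2_space \<Omega>\<close>] unfolding n_def by (meson order_trans)
    then show ?thesis using n b by (cases "n = 0") (auto simp: power2_eq_square mult.assoc[symmetric])
  qed
  ultimately show ?thesis unfolding n_def b_def by blast
qed

end
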